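(* Let $\{G_k(x)\}_{k\ge 0}$ be a generalized Fibonacci polynomial sequence which is either of Fibonacci type or of Lucas type. Then $\gcd(G_m(x),G_n(x))=G_{\gcd(m,n)}(x)$ holds for any two positive integers $m$ and $n$ if and only if $\{G_k(x)\}$ is of Fibonacci type.
   Context: All polynomials lie in $\mathbb{Z}[x]$ and $\gcd$ denotes the greatest common divisor in $\mathbb{Z}[x]$ (determined up to sign). A generalized Fibonacci polynomial (GFP) sequence $\{G_n(x)\}_{n\ge0}$ is given by $G_0(x)=p_0(x)$, $G_1(x)=p_1(x)$ and $G_n(x)=d(x)G_{n-1}(x)+g(x)G_{n-2}(x)$ for $n\ge 2$, where $p_0(x)$ is a constant and $p_1(x),d(x),g(x)$ are nonzero polynomials in $\mathbb{Z}[x]$ with $\gcd(d(x),g(x))=1$; as in the paper it is assumed that $d(x)^2+4g(x)>0$. Let $a=a(x)$, $b=b(x)$ be the roots of $z^2-d(x)z-g(x)=0$ (so $a+b=d$, $ab=-g$, $(a-b)^2=d^2+4g$). The sequence is of Lucas type if $p_0\ne 0$, $2p_1(x)=p_0\,d(x)$, $|p_0|\in\{1,2\}$, and $\gcd(p_0,p_1(x))=\gcd(p_0,d(x))=\gcd(p_0,g(x))=1$; then, with $\alpha=2/p_0$, $G_n=(a^n+b^n)/\alpha$. The sequence is of Fibonacci type if $p_0=0$ and $p_1=1$; then $G_n=(a^n-b^n)/(a-b)$. *)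

theory Defs
  imports Complex_Main "HOL-Computational_Algebra.Polynomial_Factorial"
begin

text \<open>The constant \<open>p\<^sub>0\<close> is an integer, embedded into \<open>\<int>[x]\<close> as \<open>[:p0:]\<close>.
  On \<open>int poly\<close>, \<open>gcd\<close> returns the representative with nonnegative leading coefficient and
  \<open>normalize q\<close> is whichever of \<open>q\<close>, \<open>- q\<close> has that property, so \<open>gcd p q = normalize r\<close> says that
  \<open>r\<close> is a greatest common divisor of \<open>p\<close> and \<open>q\<close> up to sign.\<close>

fun gfp_seq :: "int \<Rightarrow> int poly \<Rightarrow> int poly \<Rightarrow> int poly \<Rightarrow> nat \<Rightarrow> int poly" where
  "gfp_seq p0 p1 d g 0 = [:p0:]"
| "gfp_seq p0 p1 d g (Suc 0) = p1"
| "gfp_seq p0 p1 d g (Suc (Suc n)) = d * gfp_seq p0 p1 d g (Suc n) + g * gfp_seq p0 p1 d g n"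

text \<open>
  The inequality below is in the ordered ring \<open>\<int>[x]\<close>: a polynomial is positive iff its leading
  coefficient is positive, i.e. iff its values are positive for all large real arguments
  (lemma \<open>poly_pos_iff_eventually_pos\<close>). Demanding positive values at every real argument
  would exclude standard examples such as the Chebyshev polynomials, where
  \<open>d\<^sup>2 + 4g = 4x\<^sup>2 - 4\<close>.
\<close>

definition gfp_parameters :: "int \<Rightarrow> int poly \<Rightarrow> int poly \<Rightarrow> int poly \<Rightarrow> bool" where
  "gfp_parameters p0 p1 d g \<longleftrightarrow>
     p1 \<noteq> 0 \<and> d \<noteq> 0 \<and> g \<noteq> 0 \<and> gcd d g = 1 \<and> d\<^sup>2 + 4 * g > 0"

definition fibonacci_type :: "int \<Rightarrow> int poly \<Rightarrow> int poly \<Rightarrow> int poly \<Rightarrow> bool" where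
  "fibonacci_type p0 p1 d g \<longleftrightarrow> p0 = 0 \<and> p1 = 1"

definition lucas_type :: "int \<Rightarrow> int poly \<Rightarrow> int poly \<Rightarrow> int poly \<Rightarrow> bool" where
  "lucas_type p0 p1 d g \<longleftrightarrow>
     p0 \<noteq> 0 \<and> 2 * p1 = [:p0:] * d \<and> \<bar>p0\<bar> \<in> {1, 2} \<and>
     gcd [:p0:] p1 = 1 \<and> gcd [:p0:] d = 1 \<and> gcd [:p0:] g = 1"

lemma poly_eventually_pos:
  fixes p :: "int poly"
  assumes "0 < p"
  shows "\<exists>N. \<forall>x\<ge>N. 0 < poly (map_poly real_of_int p) x"
proof -
  let ?q = "map_poly real_of_int p"
  have "0 < coeff p (degree p)"
    using assms by (simp add: less_poly_def pos_poly_def)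
  then have lc: "0 < lead_coeff ?q"
    by (simp add: degree_map_poly coeff_map_poly)
  obtain N where "\<And>x. x \<ge> N \<Longrightarrow> lead_coeff ?q \<le> poly ?q x"
    using poly_pinfty_gt_lc[OF lc] by blast
  with lc show ?thesis
    by (meson less_le_trans)
qed

lemma poly_pos_iff_eventually_pos:
  fixes p :: "int poly"
  shows "0 < p \<longleftrightarrow> (\<exists>N. \<forall>x\<ge>N. 0 < poly (map_poly real_of_int p) x)"
proof
  assume "\<exists>N. \<forall>x\<ge>N. 0 < poly (map_poly real_of_int p) x"
  then obtain N where N: "\<And>x. x \<ge> N \<Longrightarrow> 0 < poly (map_poly real_of_int p) x"
    by blast
  show "0 < p"
  proof (rule ccontr)
    assume "\<not> 0 < p"
    then consider "p = 0" | "0 < - p"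
      by (metis neg_0_less_iff_less linorder_neqE)
    then show False
    proof cases
      case 1
      with N[of N] show False by simp
    next
      case 2
      have neg: "map_poly real_of_int (- p) = - map_poly real_of_int p"
        by (rule poly_eqI) (simp add: coeff_map_poly)
      obtain M where "\<And>x. x \<ge> M \<Longrightarrow> 0 < poly (map_poly real_of_int (- p)) x"
        using poly_eventually_pos[OF 2] by blast
      from this[of "max M N"] N[of "max M N"] show False
        by (simp add: neg)
    qed
  qed
qed (rule poly_eventually_pos)

end

theory Submission
  imports Defs
begin

text \<open>
  For Fibonacci type, the addition law and the coprimality of consecutive terms
  give \<open>gcd G\<^sub>m\<^sub>+\<^sub>n G\<^sub>n = gcd G\<^sub>m G\<^sub>n\<close>, so \<open>G\<close> commutes with the Euclidean algorithm.
  For Lucas type, the gcd property at \<open>(1, 2)\<close> and \<open>(2, 4)\<close> would yield \<open>G\<^sub>1 dvd G\<^sub>2\<close> and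
  \<open>G\<^sub>2 dvd G\<^sub>4\<close>. As \<open>G\<^sub>4\<close> is congruent to \<open>- p\<^sub>0 g\<^sup>2\<close> modulo \<open>G\<^sub>2\<close>, and \<open>G\<^sub>2\<close> is coprime to \<open>p\<^sub>0 g\<close>, both
  \<open>G\<^sub>2\<close> and \<open>G\<^sub>1\<close> are units. Then \<open>p\<^sub>0\<^sup>2 (d\<^sup>2 + 4 g) = 4 (p\<^sub>0 G\<^sub>2 - 1)\<close> is positive only if \<open>p\<^sub>0 G\<^sub>2 = 2\<close>,
  which forces \<open>g = 0\<close>.
\<close>

text \<open>The shift by \<open>Suc\<close> avoids an index \<open>m - 1\<close>. The induction
  moves one unit from \<open>m\<close> to \<open>n\<close>, so \<open>n\<close> must stay
  arbitrary.\<close>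

lemma gfp_seq_add:
  "gfp_seq 0 1 d g (Suc (m + n)) =
     gfp_seq 0 1 d g (Suc m) * gfp_seq 0 1 d g (Suc n)
     + g * gfp_seq 0 1 d g m * gfp_seq 0 1 d g n"
proof (induction m arbitrary: n)
  case (Suc m)
  from Suc[of "Suc n"] show ?case
    by (simp add: algebra_simps)
qed simp

text \<open>Modulo \<open>g\<close> each step of the recurrence is multiplication by
  \<open>d\<close>, which is coprime to \<open>g\<close>.\<close>

lemma coprime_gfp_seq_g:
  assumes "coprime d g"
  shows "coprime (gfp_seq 0 1 d g (Suc n)) g"
proof (induction n)
  case (Suc n)
  have "gcd g (gfp_seq 0 1 d g n * g + d * gfp_seq 0 1 d g (Suc n))
      = gcd g (d * gfp_seq 0 1 d g (Suc n))"
    by (rule gcd_add_mult)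
  moreover have "coprime g (d * gfp_seq 0 1 d g (Suc n))"
    using Suc assms by (simp add: coprime_commute)
  ultimately show ?case
    by (simp add: coprime_iff_gcd_eq_1 ac_simps)
qed simp

lemma coprime_gfp_seq_Suc:
  assumes "coprime d g"
  shows "coprime (gfp_seq 0 1 d g n) (gfp_seq 0 1 d g (Suc n))"
proof (induction n)
  case (Suc n)
  have "gcd (gfp_seq 0 1 d g (Suc n)) (d * gfp_seq 0 1 d g (Suc n) + g * gfp_seq 0 1 d g n)
      = gcd (gfp_seq 0 1 d g (Suc n)) (g * gfp_seq 0 1 d g n)"
    by (rule gcd_add_mult)
  moreover have "coprime (gfp_seq 0 1 d g (Suc n)) (g * gfp_seq 0 1 d g n)"
    using Suc coprime_gfp_seq_g[OF assms, of n] by (simp add: coprime_commute)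
  ultimately show ?case
    by (simp add: coprime_iff_gcd_eq_1)
qed simp

lemma gcd_gfp_seq_add:
  assumes "coprime d g"
  shows "gcd (gfp_seq 0 1 d g n) (gfp_seq 0 1 d g (m + n))
       = gcd (gfp_seq 0 1 d g n) (gfp_seq 0 1 d g m)"
proof (cases m)
  case (Suc k)
  let ?G = "gfp_seq 0 1 d g"
  \<comment> \<open>Modulo \<open>?G n\<close> the addition law leaves
    \<open>?G (Suc k) * ?G (Suc n)\<close>, whose second factor is coprime to
    \<open>?G n\<close>.\<close>
  have "gcd (?G n) (?G (m + n)) = gcd (?G n) (g * ?G k * ?G n + ?G (Suc k) * ?G (Suc n))"
    unfolding Suc add_Suc gfp_seq_add by (simp only: add.commute)
  also have "\<dots> = gcd (?G n) (?G (Suc k) * ?G (Suc n))"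
    by (rule gcd_add_mult)
  also have "\<dots> = gcd (?G n) (?G (Suc k))"
    by (rule gcd_mult_right_right_cancel) (rule coprime_gfp_seq_Suc[OF assms])
  finally show ?thesis
    by (simp only: Suc)
qed simp

lemma gcd_gfp_seq:
  assumes "coprime d g"
  shows "gcd (gfp_seq 0 1 d g m) (gfp_seq 0 1 d g n) = normalize (gfp_seq 0 1 d g (gcd m n))"
proof (induction "m + n" arbitrary: m n rule: less_induct)
  case less
  \<comment> \<open>Fixing only the sum of the indices lets this serve both \<open>(m, n)\<close>
    and \<open>(n, m)\<close> under one induction hypothesis.\<close>
  have ordered: "gcd (gfp_seq 0 1 d g i) (gfp_seq 0 1 d g j) = normalize (gfp_seq 0 1 d g (gcd i j))"
    if "i \<le> j" "i + j = m + n" for i j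
  proof (cases "i = 0")
    case False
    obtain k where k: "j = k + i"
      using \<open>i \<le> j\<close> by (metis le_add_diff_inverse2)
    have "gcd (gfp_seq 0 1 d g i) (gfp_seq 0 1 d g k) = normalize (gfp_seq 0 1 d g (gcd i k))"
      using False that k by (intro less) simp
    moreover have "gcd i (k + i) = gcd i k"
      by (metis add.commute gcd_add2)
    ultimately show ?thesis
      by (simp add: k gcd_gfp_seq_add[OF assms])
  qed simp
  show ?case
  proof (cases "m \<le> n")
    case False
    then show ?thesis
      using ordered[of n m] by (simp add: gcd.commute)
  qed (simp add: ordered)
qed

lemma square_eq_1_if_int_poly_dvd_1:
  fixes p :: "int poly"
  assumes "p dvd 1"
  shows "p\<^sup>2 = 1"
proof -
  obtain c where "p = [:c:]" "c dvd 1"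
    using assms by (auto simp: is_unit_poly_iff)
  then show ?thesis
    by (auto simp: power2_eq_square one_pCons abs_if split: if_splits)
qed

lemma lucas_type_not_gcd_closed:
  fixes p0 :: int and p1 d g :: "int poly"
  defines "G \<equiv> gfp_seq p0 p1 d g"
  assumes par: "gfp_parameters p0 p1 d g"
    and luc: "lucas_type p0 p1 d g"
    and dvd12: "G 1 dvd G 2" and dvd24: "G 2 dvd G 4"
  shows False
proof -
  have cop: "coprime d g" "coprime [:p0:] p1" "coprime [:p0:] d" "coprime [:p0:] g"
    and g: "g \<noteq> 0" and pos: "d\<^sup>2 + 4 * g > 0"
    and p1: "2 * p1 = [:p0:] * d" and p0: "p0 \<in> {1, -1, 2, -2}"
    using par luc by (auto simp: gfp_parameters_def lucas_type_def coprime_iff_gcd_eq_1)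
  have G: "G 1 = p1" "G 2 = d * p1 + g * [:p0:]" "G 4 = d * (d * G 2 + g * p1) + g * G 2"
    by (simp_all add: G_def numeral_eq_Suc)
  \<comment> \<open>The product \<open>[:p0:] * d\<close> has both factors coprime to
    \<open>g\<close>.\<close>
  have "coprime (2 * p1) g"
    unfolding p1 using cop by (simp only: coprime_mult_left_iff)
  then have "coprime p1 g"
    by simp
  then have "coprime (d * p1) g"
    using cop by simp
  then have "coprime (G 2) g"
    using gcd_add_mult[of g "[:p0:]" "d * p1"]
    by (simp add: G coprime_iff_gcd_eq_1 ac_simps)
  moreover have "coprime (d * p1) [:p0:]"
    using cop by (simp add: coprime_commute)
  then have "coprime (G 2) [:p0:]"
    using gcd_add_mult[of "[:p0:]" g "d * p1"]
    by (simp add: G coprime_iff_gcd_eq_1 ac_simps)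
  ultimately have "coprime (G 2) (g * g * [:p0:])"
    by (simp only: coprime_mult_right_iff)
  moreover have "g * g * [:p0:] = (d * d + 2 * g) * G 2 - G 4"
    unfolding G by algebra
  then have "G 2 dvd g * g * [:p0:]"
    using dvd24 by (metis dvd_diff dvd_triv_right)
  ultimately have unit2: "G 2 dvd 1"
    by (meson coprime_common_divisor dvd_refl)
  then have "p1 dvd 1"
    using dvd12 G(1) by (metis dvd_trans)
  then have p1sq: "p1\<^sup>2 = 1"
    by (rule square_eq_1_if_int_poly_dvd_1)
  \<comment> \<open>Since \<open>2 * p1 = [:p0:] * d\<close> and \<open>p1\<^sup>2 = 1\<close>, it
    follows that \<open>[:p0:] * d * p1 = 2\<close> and
    \<open>[:p0:]\<^sup>2 * d\<^sup>2 = 4\<close>.\<close>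
  have disc: "[:p0:]\<^sup>2 * (d\<^sup>2 + 4 * g) = 4 * ([:p0:] * G 2 - 1)"
    and g4: "[:p0:]\<^sup>2 * g = [:p0:] * G 2 - 2"
    using p1 p1sq unfolding G by algebra+
  have "[:p0:]\<^sup>2 > 0"
    using p0 by auto
  with pos have "[:p0:]\<^sup>2 * (d\<^sup>2 + 4 * g) > 0"
    by (rule mult_pos_pos[rotated])
  then have big: "[:p0:] * G 2 - 1 > 0"
    unfolding disc by (rule zero_less_mult_pos) simp
  obtain c where c: "G 2 = [:c:]" "c dvd 1"
    using unit2 by (auto simp: is_unit_poly_iff)
  have "p0 * c > 1"
    using big by (auto simp: c(1) one_pCons less_poly_def pos_poly_pCons mult.commute)
  \<comment> \<open>As \<open>c\<close> is 1 or -1, the product has absolute value 1 or 2.\<close>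
  then have "p0 * c = 2"
    using p0 c(2) by auto
  then have "[:p0:]\<^sup>2 * g = 0"
    unfolding g4 c(1) by (simp add: numeral_poly mult.commute)
  with g p0 show False
    by auto
qed

theorem theorem19:
  fixes p0 :: int and p1 d g :: "int poly"
  assumes "gfp_parameters p0 p1 d g"
    and "fibonacci_type p0 p1 d g \<or> lucas_type p0 p1 d g"
  shows "(\<forall>m n :: nat. 0 < m \<longrightarrow> 0 < n \<longrightarrow>
            gcd (gfp_seq p0 p1 d g m) (gfp_seq p0 p1 d g n) = normalize (gfp_seq p0 p1 d g (gcd m n)))
         \<longleftrightarrow> fibonacci_type p0 p1 d g"
proof
  assume "fibonacci_type p0 p1 d g"
  moreover have "coprime d g"
    using assms(1) by (simp add: gfp_parameters_def coprime_iff_gcd_eq_1)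
  ultimately show "\<forall>m n :: nat. 0 < m \<longrightarrow> 0 < n \<longrightarrow>
      gcd (gfp_seq p0 p1 d g m) (gfp_seq p0 p1 d g n) = normalize (gfp_seq p0 p1 d g (gcd m n))"
    by (simp add: fibonacci_type_def gcd_gfp_seq)
next
  assume gcd_closed: "\<forall>m n :: nat. 0 < m \<longrightarrow> 0 < n \<longrightarrow>
      gcd (gfp_seq p0 p1 d g m) (gfp_seq p0 p1 d g n) = normalize (gfp_seq p0 p1 d g (gcd m n))"
  \<comment> \<open>Here \<open>gcd m n = m\<close>, so the term at \<open>m\<close> is itself a gcd
    of the two terms up to sign.\<close>
  have dvd: "gfp_seq p0 p1 d g m dvd gfp_seq p0 p1 d g n" if "0 < m" "0 < n" "m dvd n" for m n
    using gcd_closed that by (metis gcd_nat.absorb1 gcd_dvd2 normalize_dvd_iff)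
  show "fibonacci_type p0 p1 d g"
    using lucas_type_not_gcd_closed[OF assms(1)] assms(2) dvd[of 1 2] dvd[of 2 4] by auto
qed

end
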